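(* Let $(T_n(X))_{n\ge 0}$ be a Carlitz-type $q$-polynomial sequence with associated real sequence $(a_k)_{k\ge 0}$. Then: 1. The sequence $\left(q^X\,n\,T_{n-1}(X)\right)_{n\ge 0}$ is a Carlitz-type $q$-polynomial sequence with associated real sequence $\left((q-1)\,k\,a_{k-1}\right)_{k\ge 0}$. 2. If $T_0(X)$ is identically zero (i.e. $a_0=0$), then the sequence $\left(\frac{q^{-X}T_{n+1}(X)}{n+1}\right)_{n\ge 0}$ is a Carlitz-type $q$-polynomial sequence with associated real sequence $\left(\frac{1}{q-1}\,\frac{a_{k+1}}{k+1}\right)_{k\ge 0}$. 3. The sequence $\left(q^{-X}\left(T_n(X)+(q-1)T_{n+1}(X)\right)\right)_{n\ge 0}$ is a Carlitz-type $q$-polynomial sequence with associated real sequence $(a_{k+1})_{k\ge 0}$. 4. The sequence $\left(n\left(T_{n-1}(X)+(q-1)T_n(X)\right)\right)_{n\ge 0}$ is a Carlitz-type $q$-polynomial sequence with associated real sequence $\left((q-1)\,k\,a_k\right)_{k\ge 0}$.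
   Context: Let $q$ be a positive real number, $q\neq 1$, and put $[X]:=\frac{q^X-1}{q-1}$. A $q$-polynomial is a polynomial in $[X]$ (equivalently, in $q^X$) with real coefficients. A sequence $(T_n(X))_{n\ge 0}$ of $q$-polynomials is called Carlitz-type, with associated real sequence $(a_k)_{k\ge 0}$, if for all integers $n\ge 0$ $$T_n(X)=(q-1)^{-n}\sum_{k=0}^{n}(-1)^{n-k}\binom{n}{k}a_k\,q^{kX}.$$ Convention: for a real or functional sequence $(f_n)_{n\ge 0}$, expressions such as $n f_{n-1}$ (and $k a_{k-1}$) are understood to be $0$ when the index $n$ (resp. $k$) is $0$. *)

theory Defs
  imports Complex_Main "HOL-Computational_Algebra.Polynomial"
begin

definition q_bracket :: "real \<Rightarrow> real \<Rightarrow> real" where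
  "q_bracket q X = (q powr X - 1) / (q - 1)"

(* q-polynomials are rendered as functions of the real variable X. For q > 0, q \<noteq> 1 the map
   q_bracket q takes infinitely many values, so the polynomial p is determined by f. *)
definition q_polynomial :: "real \<Rightarrow> (real \<Rightarrow> real) \<Rightarrow> bool" where
  "q_polynomial q f \<longleftrightarrow> (\<exists>p :: real poly. \<forall>X. f X = poly p (q_bracket q X))"

definition carlitz_type :: "real \<Rightarrow> (nat \<Rightarrow> real \<Rightarrow> real) \<Rightarrow> (nat \<Rightarrow> real) \<Rightarrow> bool" where
  "carlitz_type q T a \<longleftrightarrow>
     (\<forall>n. q_polynomial q (T n)) \<and>
     (\<forall>n X. T n X = (q - 1) powi (- int n) *
        (\<Sum>k = 0..n. (-1) ^ (n - k) * real (n choose k) * a k * q powr (real k * X)))"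

lemma q_polynomial_iff_powr:
  assumes "q \<noteq> 1"
  shows "q_polynomial q f \<longleftrightarrow> (\<exists>p :: real poly. \<forall>X. f X = poly p (q powr X))"
proof
  assume "q_polynomial q f"
  then obtain p :: "real poly" where p: "\<And>X. f X = poly p (q_bracket q X)"
    unfolding q_polynomial_def by blast
  have "f X = poly (pcompose p [:- 1 / (q - 1), 1 / (q - 1):]) (q powr X)" for X
    by (simp add: p poly_pcompose q_bracket_def diff_divide_distrib)
  then show "\<exists>p :: real poly. \<forall>X. f X = poly p (q powr X)" by blast
next
  assume "\<exists>p :: real poly. \<forall>X. f X = poly p (q powr X)"
  then obtain p :: "real poly" where p: "\<And>X. f X = poly p (q powr X)" by blast
  have "f X = poly (pcompose p [:1, q - 1:]) (q_bracket q X)" for X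
    using assms by (simp add: p poly_pcompose q_bracket_def)
  then show "q_polynomial q f" unfolding q_polynomial_def by blast
qed

lemma carlitz_type_0_iff:
  assumes "0 < q" and "carlitz_type q T a"
  shows "(\<forall>X. T 0 X = 0) \<longleftrightarrow> a 0 = 0"
  using assms by (simp add: carlitz_type_def)

end

theory Submission
  imports Defs
begin

text \<open>
  Writing \<open>x = q\<^sup>X\<close>, a Carlitz-type sequence satisfies \<open>(q - 1)\<^sup>n T\<^sub>n(X) = (\<Delta>\<^sup>n b)(0)\<close> with
  \<open>b\<^sub>k = a\<^sub>k x\<^sup>k\<close>, where \<open>\<Delta>\<close> is the forward difference. The four claims are the two rules
  \<open>\<Delta>\<^sup>n\<^sup>+\<^sup>1 (k b\<^sub>k\<^sub>-\<^sub>1) = (n + 1) \<Delta>\<^sup>n b\<close> and \<open>\<Delta>\<^sup>n (b\<^sub>k\<^sub>+\<^sub>1) = \<Delta>\<^sup>n b + \<Delta>\<^sup>n\<^sup>+\<^sup>1 b\<close> at \<open>0\<close>.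
\<close>

text \<open>The \<open>n\<close>-th forward difference of \<open>b\<close> at 0, in closed binomial
  form so that it matches the sum in \<open>carlitz_type\<close> term by term.\<close>

definition fdiff :: "nat \<Rightarrow> (nat \<Rightarrow> 'a::comm_ring_1) \<Rightarrow> 'a" where
  "fdiff n b = (\<Sum>k\<le>n. (-1) ^ (n - k) * of_nat (n choose k) * b k)"

lemma fdiff_0 [simp]: "fdiff 0 b = b 0"
  by (simp add: fdiff_def)

lemma fdiff_scale: "fdiff n (\<lambda>k. c * b k) = c * fdiff n b"
  by (simp add: fdiff_def sum_distrib_left mult_ac)

text \<open>The term at 0 vanishes; after an index shift this is the absorption identity for
  binomial coefficients.\<close>

lemma fdiff_Suc_index_mult:
  "fdiff (Suc n) (\<lambda>k. of_nat k * b (k - 1)) = of_nat (Suc n) * fdiff n b"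
proof -
  have *: "of_nat (Suc n choose Suc k) * of_nat (Suc k) = of_nat (Suc n) * (of_nat (n choose k) :: 'a)"
    for k
    using Suc_times_binomial[of k n] by (metis mult.commute of_nat_mult)
  have "fdiff (Suc n) (\<lambda>k. of_nat k * b (k - 1)) =
      (\<Sum>k\<le>n. (-1) ^ (n - k) * (of_nat (Suc n choose Suc k) * of_nat (Suc k)) * b k)"
    unfolding fdiff_def by (subst sum.atMost_Suc_shift) (simp add: mult.assoc)
  also have "\<dots> = of_nat (Suc n) * fdiff n b"
    unfolding * by (simp add: fdiff_def sum_distrib_left mult_ac)
  finally show ?thesis .
qed

text \<open>Pascal's rule splits the terms of \<open>fdiff (Suc n) b\<close> with positive index:
  one half is the shifted difference, the other joins the term at 0 to give
  \<open>- fdiff n b\<close>.\<close>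

lemma fdiff_shift: "fdiff n (\<lambda>k. b (Suc k)) = fdiff n b + fdiff (Suc n) b"
proof -
  let ?s = "\<lambda>k. (-1) ^ (n - k) * of_nat (n choose Suc k) * b (Suc k)"
  have "fdiff (Suc n) b = (-1) ^ Suc n * b 0 +
      (\<Sum>k\<le>n. (-1) ^ (n - k) * of_nat (n choose k) * b (Suc k) + ?s k)"
    unfolding fdiff_def by (subst sum.atMost_Suc_shift) (simp add: algebra_simps)
  also have "\<dots> = fdiff n (\<lambda>k. b (Suc k)) + ((-1) ^ Suc n * b 0 + sum ?s {..n})"
    by (simp add: fdiff_def sum.distrib)
  also have "(-1) ^ Suc n * b 0 + sum ?s {..n} = - fdiff n b"
  proof -
    \<comment> \<open>The added term has binomial coefficient 0; it makes the index shift land on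
      the range \<open>k \<le> n\<close> of \<open>?s\<close>.\<close>
    have "fdiff n b = (\<Sum>k\<le>Suc n. (-1) ^ (n - k) * of_nat (n choose k) * b k)"
      by (simp add: fdiff_def binomial_eq_0)
    also have "\<dots> = (-1) ^ n * b 0 + (\<Sum>k\<le>n. (-1) ^ (n - Suc k) * of_nat (n choose Suc k) * b (Suc k))"
      by (subst sum.atMost_Suc_shift) simp
    also have "(\<Sum>k\<le>n. (-1) ^ (n - Suc k) * of_nat (n choose Suc k) * b (Suc k)) = (\<Sum>k\<le>n. - ?s k)"
    proof (rule sum.cong)
      fix k
      show "(-1) ^ (n - Suc k) * of_nat (n choose Suc k) * b (Suc k) = - ?s k"
      \<comment> \<open>At \<open>k = n\<close> truncated subtraction spoils the sign relation, but
        \<open>n choose Suc n\<close> is 0.\<close>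
      proof (cases "k < n")
        case True
        then have "n - k = Suc (n - Suc k)" by simp
        then show ?thesis by simp
      qed (simp add: binomial_eq_0)
    qed simp
    finally show ?thesis by (simp add: sum_negf)
  qed
  finally show ?thesis by simp
qed

text \<open>The formula already exhibits \<open>T n\<close> as a polynomial in
  \<open>q powr X\<close>, so being a q-polynomial follows from it, and \<open>q - 1\<close> is
  invertible. Each claim thus becomes an identity between differences.\<close>

lemma carlitz_type_iff_fdiff:
  assumes "0 < q" "q \<noteq> 1"
  shows "carlitz_type q T a \<longleftrightarrow>
    (\<forall>n X. (q - 1) ^ n * T n X = fdiff n (\<lambda>k. a k * (q powr X) ^ k))"
proof -
  have eq: "(q - 1) powi (- int n) *
      (\<Sum>k = 0..n. (-1) ^ (n - k) * real (n choose k) * a k * q powr (real k * X)) =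
      fdiff n (\<lambda>k. a k * (q powr X) ^ k) / (q - 1) ^ n" for n X
  proof -
    have "q powr (real k * X) = (q powr X) ^ k" for k
      using assms by (simp add: powr_power mult.commute)
    then show ?thesis
      by (simp add: fdiff_def power_int_minus atLeast0AtMost divide_inverse mult_ac)
  qed
  have poly: "q_polynomial q (T n)"
    if "\<And>X. T n X = fdiff n (\<lambda>k. a k * (q powr X) ^ k) / (q - 1) ^ n" for n
  proof -
    define p where "p = (\<Sum>k\<le>n. monom ((-1) ^ (n - k) * real (n choose k) * a k / (q - 1) ^ n) k)"
    have "T n X = poly p (q powr X)" for X
      by (simp add: that p_def fdiff_def poly_sum poly_monom sum_divide_distrib mult_ac)
    then show ?thesis using assms(2) q_polynomial_iff_powr by blast
  qed
  have "carlitz_type q T a \<longleftrightarrow>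
      (\<forall>n X. T n X = fdiff n (\<lambda>k. a k * (q powr X) ^ k) / (q - 1) ^ n)"
    unfolding carlitz_type_def eq using poly by blast
  then show ?thesis using assms by (simp add: field_simps)
qed

theorem proposition2p11:
  fixes q :: real and T :: "nat \<Rightarrow> real \<Rightarrow> real" and a :: "nat \<Rightarrow> real"
  assumes "0 < q" and "q \<noteq> 1"
    and "carlitz_type q T a"
  shows "carlitz_type q
           (\<lambda>n X. q powr X * real n * T (n - 1) X)
           (\<lambda>k. (q - 1) * real k * a (k - 1))
       \<and> ((\<forall>X. T 0 X = 0) \<longrightarrow>
         carlitz_type q
           (\<lambda>n X. q powr (- X) * T (n + 1) X / real (n + 1))
           (\<lambda>k. 1 / (q - 1) * (a (k + 1) / real (k + 1))))
       \<and> carlitz_type q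
           (\<lambda>n X. q powr (- X) * (T n X + (q - 1) * T (n + 1) X))
           (\<lambda>k. a (k + 1))
       \<and> carlitz_type q
           (\<lambda>n X. real n * (T (n - 1) X + (q - 1) * T n X))
           (\<lambda>k. (q - 1) * real k * a k)"
proof (intro conjI impI)
  have car: "carlitz_type q U b \<longleftrightarrow>
      (\<forall>n X. (q - 1) ^ n * U n X = fdiff n (\<lambda>k. b k * (q powr X) ^ k))" for U b
    by (rule carlitz_type_iff_fdiff) (use assms in auto)
  have T: "fdiff n (\<lambda>k. a k * (q powr X) ^ k) = (q - 1) ^ n * T n X" for n X
    using assms(3) by (simp add: car)
  have x: "q powr X > 0" for X
    using assms(1) by simp
  have shift: "fdiff n (\<lambda>k. a (Suc k) * (q powr X) ^ Suc k) =
      (q - 1) ^ n * (T n X + (q - 1) * T (Suc n) X)" for n X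
    using fdiff_shift[of n "\<lambda>k. a k * (q powr X) ^ k"] by (simp only: T) (simp add: algebra_simps)
  have idx: "fdiff (Suc n) (\<lambda>k. real k * b (k - 1)) = real (Suc n) * fdiff n b" for n b
    by (rule fdiff_Suc_index_mult)
  show "carlitz_type q (\<lambda>n X. q powr X * real n * T (n - 1) X)
      (\<lambda>k. (q - 1) * real k * a (k - 1))"
    unfolding car
  proof (intro allI)
    fix n X
    let ?x = "q powr X"
    \<comment> \<open>One factor \<open>?x\<close> is pulled out of the power; at
      \<open>k = 0\<close> the factor \<open>real k\<close> kills both sides, whatever
      \<open>a (0 - 1)\<close> is.\<close>
    have eq: "(\<lambda>k. (q - 1) * real k * a (k - 1) * ?x ^ k) =
        (\<lambda>k. ((q - 1) * ?x) * (real k * (a (k - 1) * ?x ^ (k - 1))))"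
    proof
      show "(q - 1) * real k * a (k - 1) * ?x ^ k =
          (q - 1) * ?x * (real k * (a (k - 1) * ?x ^ (k - 1)))" for k
        by (cases k) simp_all
    qed
    show "(q - 1) ^ n * (?x * real n * T (n - 1) X) =
        fdiff n (\<lambda>k. (q - 1) * real k * a (k - 1) * ?x ^ k)"
    proof (cases n)
      case (Suc m)
      show ?thesis
        unfolding Suc eq fdiff_scale idx[of m "\<lambda>k. a k * ?x ^ k"] T by simp
    qed simp
  qed
  show "carlitz_type q (\<lambda>n X. q powr (- X) * T (n + 1) X / real (n + 1))
      (\<lambda>k. 1 / (q - 1) * (a (k + 1) / real (k + 1)))"
    if "\<forall>X. T 0 X = 0"
    unfolding car
  proof (intro allI)
    fix n X
    let ?x = "q powr X"
    let ?b = "\<lambda>k. 1 / (q - 1) * (a (k + 1) / real (k + 1)) * ?x ^ k"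
    have a0: "a 0 = 0"
      using carlitz_type_0_iff[OF assms(1,3)] that by simp
    \<comment> \<open>The index rule is now read backwards. The left side is 0 at
      \<open>k = 0\<close>, so the right side must be too: this is where \<open>a 0 = 0\<close>
      enters.\<close>
    have eq: "(\<lambda>k. real k * ?b (k - 1)) = (\<lambda>k. 1 / ((q - 1) * ?x) * (a k * ?x ^ k))"
    proof
      show "real k * ?b (k - 1) = 1 / ((q - 1) * ?x) * (a k * ?x ^ k)" for k
        using x[of X] assms(2) a0 by (cases k) (simp_all add: divide_simps del: of_nat_Suc)
    qed
    have "real (Suc n) * fdiff n ?b = 1 / ((q - 1) * ?x) * ((q - 1) ^ Suc n * T (Suc n) X)"
      unfolding idx[of n ?b, symmetric] eq fdiff_scale T ..
    also have "\<dots> = real (Suc n) * ((q - 1) ^ n * (q powr (- X) * T (n + 1) X / real (n + 1)))"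
      using assms(2) x[of X] by (simp add: powr_minus divide_simps del: of_nat_Suc)
    finally show "(q - 1) ^ n * (q powr (- X) * T (n + 1) X / real (n + 1)) = fdiff n ?b"
      by (simp only: mult_left_cancel[OF of_nat_neq_0])
  qed
  show "carlitz_type q (\<lambda>n X. q powr (- X) * (T n X + (q - 1) * T (n + 1) X)) (\<lambda>k. a (k + 1))"
    unfolding car
  proof (intro allI)
    fix n X
    let ?x = "q powr X"
    \<comment> \<open>The factor \<open>?x\<close> raises each exponent to \<open>Suc k\<close>, as
      \<open>shift\<close> requires; dividing by it yields \<open>q powr (- X)\<close>.\<close>
    have "?x * fdiff n (\<lambda>k. a (k + 1) * ?x ^ k) = (q - 1) ^ n * (T n X + (q - 1) * T (n + 1) X)"
      using shift[of n X] by (simp add: fdiff_scale[symmetric] mult_ac)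
    then show "(q - 1) ^ n * (q powr (- X) * (T n X + (q - 1) * T (n + 1) X)) =
        fdiff n (\<lambda>k. a (k + 1) * ?x ^ k)"
      using x[of X] by (simp add: powr_minus field_simps)
  qed
  show "carlitz_type q (\<lambda>n X. real n * (T (n - 1) X + (q - 1) * T n X))
      (\<lambda>k. (q - 1) * real k * a k)"
    unfolding car
  proof (intro allI)
    fix n X
    let ?x = "q powr X"
    \<comment> \<open>Writing \<open>k\<close> as \<open>Suc (k - 1)\<close>, harmless at 0 because
      of \<open>real k\<close>, lets the index rule act on the shifted sequence, so both rules
      combine.\<close>
    have eq: "(\<lambda>k. (q - 1) * real k * a k * ?x ^ k) =
        (\<lambda>k. (q - 1) * (real k * (a (Suc (k - 1)) * ?x ^ Suc (k - 1))))"
    proof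
      show "(q - 1) * real k * a k * ?x ^ k =
          (q - 1) * (real k * (a (Suc (k - 1)) * ?x ^ Suc (k - 1)))" for k
        by (cases k) simp_all
    qed
    show "(q - 1) ^ n * (real n * (T (n - 1) X + (q - 1) * T n X)) =
        fdiff n (\<lambda>k. (q - 1) * real k * a k * ?x ^ k)"
    proof (cases n)
      case (Suc m)
      show ?thesis
        unfolding Suc eq fdiff_scale idx[of m "\<lambda>k. a (Suc k) * ?x ^ Suc k"] shift by simp
    qed simp
  qed
qed

end
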